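(* Let $\mathcal{H}$ be a complex Hilbert space, let $a,b,x,y\in\mathcal{H}$ and assume that the quantity \[ \Delta=\sqrt{\left(|\langle x,b\rangle|^2+|\langle y,b\rangle|^2\right)^2-4\left(\operatorname{Im}(\langle x,b\rangle\langle b,y\rangle)\right)^2} \] is strictly positive. Then \[ |\langle a,y\rangle|\leq\frac{\left(\|x\|^2+\|y\|^2\right)\Big(\|a\|\|b\|+\delta\,|\langle a,b\rangle|\Big)}{\sqrt{2\left(|\langle x,b\rangle|^2+|\langle y,b\rangle|^2+\Delta\right)}}, \] where \[ \delta=\sqrt{\frac{\Delta-|\langle x,b\rangle|^2+|\langle y,b\rangle|^2}{2\Delta}}. \]
   Context: The inner product $\langle\cdot,\cdot\rangle$ of $\mathcal{H}$ is linear in the first argument, and $\|\cdot\|$ is the induced norm. *)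

theory Defs
  imports "HOL-Analysis.Analysis"
begin

text \<open>
  The class \<^class>\<open>banach\<close> supplies completeness with respect to \<^const>\<open>norm\<close>; the axioms
  below equip such a space with a compatible complex scalar multiplication and an inner
  product, linear in its first argument, that induces this norm. By \<open>cinner_commute\<close>,
  the value \<open>cinner x x\<close> is real, so nothing is lost by taking real parts.
\<close>

class chilbert_space = banach +
  fixes scaleC :: "complex \<Rightarrow> 'a \<Rightarrow> 'a" (infixr "*\<^sub>C" 75)
    and cinner :: "'a \<Rightarrow> 'a \<Rightarrow> complex"
  assumes scaleC_add_right: "c *\<^sub>C (x + y) = c *\<^sub>C x + c *\<^sub>C y"
    and scaleC_add_left: "(c + d) *\<^sub>C x = c *\<^sub>C x + d *\<^sub>C x"
    and scaleC_scaleC: "c *\<^sub>C d *\<^sub>C x = (c * d) *\<^sub>C x"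
    and scaleC_one: "1 *\<^sub>C x = x"
    and scaleR_scaleC: "r *\<^sub>R x = complex_of_real r *\<^sub>C x"
    and cinner_commute: "cinner x y = cnj (cinner y x)"
    and cinner_add_left: "cinner (x + y) z = cinner x z + cinner y z"
    and cinner_scaleC_left: "cinner (c *\<^sub>C x) y = c * cinner x y"
    and cinner_ge_zero: "0 \<le> Re (cinner x x)"
    and cinner_eq_zero_iff: "cinner x x = 0 \<longleftrightarrow> x = 0"
    and norm_eq_sqrt_cinner: "norm x = sqrt (Re (cinner x x))"

instantiation complex :: chilbert_space
begin

definition scaleC_complex :: "complex \<Rightarrow> complex \<Rightarrow> complex" where
  "scaleC_complex c x = c * x"

definition cinner_complex :: "complex \<Rightarrow> complex \<Rightarrow> complex" where
  "cinner_complex x y = x * cnj y"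

instance
proof
  fix x :: complex
  show "norm x = sqrt (Re (cinner x x))"
    by (simp add: cinner_complex_def cmod_def power2_eq_square)
qed (simp_all add: scaleC_complex_def cinner_complex_def algebra_simps scaleR_conv_of_real)

end

end

theory Submission
  imports Defs
begin

text \<open>
  Write \<open>u = \<langle>x,b\<rangle>\<close>, \<open>v = \<langle>y,b\<rangle>\<close>. The square of \<open>|\<langle>\<sigma> x + \<tau> y, b\<rangle>|\<close>, for real \<open>\<sigma>\<close>, \<open>\<tau>\<close>, is the
  quadratic form with matrix entries \<open>|u|\<^sup>2\<close>, \<open>|v|\<^sup>2\<close> and off-diagonal entry \<open>r = Re (u cnj v)\<close>.
  Because \<open>|u|\<^sup>2 |v|\<^sup>2 = r\<^sup>2 + (Im (u cnj v))\<^sup>2\<close>, the number \<open>\<Delta>\<close> satisfies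
  \<open>\<Delta>\<^sup>2 = (|u|\<^sup>2 - |v|\<^sup>2)\<^sup>2 + 4 r\<^sup>2\<close>, so it is the gap between the two eigenvalues of this form, and
  the larger eigenvalue is \<open>(|u|\<^sup>2 + |v|\<^sup>2 + \<Delta>) / 2\<close>. A unit eigenvector is \<open>(c, s)\<close> with
  \<open>s = \<delta>\<close> and a suitable sign of \<open>c\<close> (\<open>principal_axis\<close>).

  Now rotate the pair \<open>(x, y)\<close> to \<open>X = c x + s y\<close>, \<open>Y = c y - s x\<close>. This preserves
  \<open>N = \<parallel>x\<parallel>\<^sup>2 + \<parallel>y\<parallel>\<^sup>2\<close>, gives \<open>y = s X + c Y\<close>, and makes \<open>2 |\<langle>X,b\<rangle>|\<close> equal to the denominator of
  the claim. What remains is a Buzano type inequality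
  \<open>2 |\<langle>a,y\<rangle>| |\<langle>X,b\<rangle>| \<le> N (\<parallel>a\<parallel> \<parallel>b\<parallel> + |s| |\<langle>a,b\<rangle>|)\<close> (\<open>buzano_rotated\<close>). It follows from
  \<open>\<langle>a,y\<rangle>\<langle>X,b\<rangle> - (s N / 2) \<langle>a,b\<rangle> = \<langle>T a, b\<rangle>\<close>, where \<open>T z = \<langle>z,y\<rangle> X - (s N / 2) z\<close> has operator
  norm at most \<open>N / 2\<close> (\<open>norm_shifted_rank_one_le\<close>).
\<close>

section \<open>Complex inner products\<close>

lemma cinner_add_right: "cinner x (y + z) = cinner x y + cinner x (z :: 'a :: chilbert_space)"
  by (metis cinner_add_left cinner_commute complex_cnj_add)

lemma cinner_scaleC_right: "cinner x (k *\<^sub>C y) = cnj k * cinner x (y :: 'a :: chilbert_space)"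
  by (metis cinner_commute cinner_scaleC_left complex_cnj_mult)

lemma cinner_scaleR_left: "cinner (r *\<^sub>R x) y = of_real r * cinner x (y :: 'a :: chilbert_space)"
  by (simp add: scaleR_scaleC cinner_scaleC_left)

lemma cinner_scaleR_right: "cinner x (r *\<^sub>R y) = of_real r * cinner x (y :: 'a :: chilbert_space)"
  by (simp add: scaleR_scaleC cinner_scaleC_right)

lemma cinner_diff_left: "cinner (x - y) z = cinner x z - cinner y (z :: 'a :: chilbert_space)"
  by (metis add_diff_cancel diff_add_cancel cinner_add_left)

lemma power2_norm_eq_cinner: "(norm x)\<^sup>2 = Re (cinner x (x :: 'a :: chilbert_space))"
  by (simp add: norm_eq_sqrt_cinner cinner_ge_zero)

lemma power2_norm_add:
  "(norm (x + y))\<^sup>2 = (norm x)\<^sup>2 + (norm y)\<^sup>2 + 2 * Re (cinner x (y :: 'a :: chilbert_space))"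
proof -
  have "Re (cinner y x) = Re (cinner x y)"
    by (subst cinner_commute) simp
  then show ?thesis
    by (simp add: power2_norm_eq_cinner cinner_add_left cinner_add_right)
qed

lemma norm_scaleC: "norm (k *\<^sub>C x) = cmod k * norm (x :: 'a :: chilbert_space)"
proof -
  have "cinner (k *\<^sub>C x) (k *\<^sub>C x) = of_real ((cmod k)\<^sup>2) * cinner x x"
    by (simp only: cinner_scaleC_left cinner_scaleC_right complex_norm_square)
       (simp add: algebra_simps)
  then have "(norm (k *\<^sub>C x))\<^sup>2 = (cmod k * norm x)\<^sup>2"
    by (simp add: power2_norm_eq_cinner power_mult_distrib flip: of_real_power)
  then show ?thesis by simp
qed

text \<open>
  The triangle inequality, squared, is already the bound for the real part of the inner product;
  a rotation of \<open>x\<close> by the phase of the inner product does the rest.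
\<close>

lemma cinner_Cauchy_Schwarz: "cmod (cinner x y) \<le> norm x * norm (y :: 'a :: chilbert_space)"
proof -
  have real_part: "Re (cinner z y) \<le> norm z * norm y" for z
  proof -
    have "(norm (z + y))\<^sup>2 \<le> (norm z + norm y)\<^sup>2"
      by (intro power_mono norm_triangle_ineq) simp
    then show ?thesis
      by (simp add: power2_norm_add power2_sum)
  qed
  define k where "k = cinner x y"
  have "(cmod k)\<^sup>2 = Re (cinner (cnj k *\<^sub>C x) y)"
    by (simp add: cinner_scaleC_left cmod_power2 flip: k_def) (simp add: power2_eq_square)
  also have "\<dots> \<le> cmod k * (norm x * norm y)"
    using real_part[of "cnj k *\<^sub>C x"] by (simp add: norm_scaleC mult.assoc)
  finally show ?thesis
    unfolding k_def by (cases "cinner x y = 0") (simp_all add: power2_eq_square)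
qed

section \<open>A shifted rank one operator\<close>

text \<open>
  This is the scalar core of the operator norm bound. Multiplied by \<open>B\<close>, the difference of the two
  sides is \<open>c\<^sup>2 ((A + B) / 2)\<^sup>2 (B Z - |\<beta>|\<^sup>2)\<close> plus a completed square.
\<close>

lemma rank_one_form_le:
  fixes \<gamma> \<beta> :: complex and A B Z c :: real
  assumes "A \<ge> 0" "B \<ge> 0" "Z \<ge> 0" and \<beta>: "(cmod \<beta>)\<^sup>2 \<le> B * Z"
  shows "A * (cmod (\<gamma> + of_real c * \<beta>))\<^sup>2 - (A + B) * Re ((\<gamma> + of_real c * \<beta>) * cnj \<gamma>)
           \<le> c\<^sup>2 * ((A + B) / 2)\<^sup>2 * Z" (is "?L \<le> ?R")
proof (cases "B = 0")
  case True
  with \<beta> have "\<beta> = 0" by simp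
  with True \<open>Z \<ge> 0\<close> show ?thesis
    using \<open>A \<ge> 0\<close> by (simp add: cmod_power2 power_divide) (simp add: power2_eq_square algebra_simps)
next
  case False
  have "B * ?L = c\<^sup>2 * ((A + B) / 2)\<^sup>2 * (cmod \<beta>)\<^sup>2
                 - (cmod (of_real B * \<gamma> - of_real (c * (A - B) / 2) * \<beta>))\<^sup>2"
    unfolding cmod_power2 by (simp add: field_simps power2_eq_square)
  also have "\<dots> \<le> c\<^sup>2 * ((A + B) / 2)\<^sup>2 * (B * Z)"
    using mult_left_mono[OF \<beta>, of "c\<^sup>2 * ((A + B) / 2)\<^sup>2"] by (smt (verit) zero_le_power2 mult_nonneg_nonneg)
  finally have "B * ?L \<le> B * ?R" by (simp add: mult_ac)
  with False \<open>B \<ge> 0\<close> show ?thesis by simp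
qed

text \<open>
  The shift by \<open>s N / 2\<close> is what turns the trivial bound \<open>\<parallel>X\<parallel> \<parallel>y\<parallel>\<close> for the rank one operator into
  \<open>N / 2\<close>; for \<open>s = 1\<close>, \<open>c = 0\<close>, \<open>Y = 0\<close> it is the fact that twice a projection minus the identity is
  a contraction, which yields Buzano's inequality.
\<close>

lemma norm_shifted_rank_one_le:
  fixes X Y y z :: "'a :: chilbert_space" and s c N :: real
  assumes unit: "s\<^sup>2 + c\<^sup>2 = 1"
    and y: "y = s *\<^sub>R X + c *\<^sub>R Y"
    and N: "N = (norm X)\<^sup>2 + (norm Y)\<^sup>2"
  shows "norm (cinner z y *\<^sub>C X - (s * N / 2) *\<^sub>R z) \<le> N / 2 * norm z"
proof -
  define \<gamma> where "\<gamma> = of_real s * cinner z X"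
  define \<beta> where "\<beta> = cinner z Y"
  define k where "k = cinner z y"
  have k: "k = \<gamma> + of_real c * \<beta>"
    by (simp add: k_def \<gamma>_def \<beta>_def y cinner_add_right cinner_scaleR_right)
  have "(cmod \<beta>)\<^sup>2 \<le> (norm z * norm Y)\<^sup>2"
    unfolding \<beta>_def by (intro power_mono cinner_Cauchy_Schwarz) simp
  then have \<beta>: "(cmod \<beta>)\<^sup>2 \<le> (norm Y)\<^sup>2 * (norm z)\<^sup>2"
    by (simp add: power_mult_distrib mult.commute)
  have "cinner X z = cnj (cinner z X)" by (rule cinner_commute)
  then have cross: "Re (cinner (k *\<^sub>C X) ((- (s * N / 2)) *\<^sub>R z)) = - (N / 2) * Re (k * cnj \<gamma>)"
    by (simp add: cinner_scaleC_left cinner_scaleR_right \<gamma>_def algebra_simps del: scaleR_minus_left)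
  have "(norm (k *\<^sub>C X - (s * N / 2) *\<^sub>R z))\<^sup>2
        = (norm X)\<^sup>2 * (cmod k)\<^sup>2 - N * Re (k * cnj \<gamma>) + s\<^sup>2 * (N / 2)\<^sup>2 * (norm z)\<^sup>2"
    using power2_norm_add[of "k *\<^sub>C X" "(- (s * N / 2)) *\<^sub>R z"] unfolding cross
    by (simp add: norm_scaleC power_mult_distrib power_divide)
  also have "\<dots> \<le> c\<^sup>2 * (N / 2)\<^sup>2 * (norm z)\<^sup>2 + s\<^sup>2 * (N / 2)\<^sup>2 * (norm z)\<^sup>2"
    using rank_one_form_le[of "(norm X)\<^sup>2" "(norm Y)\<^sup>2" "(norm z)\<^sup>2" \<beta> \<gamma> c] \<beta>
    by (simp add: k N)
  also have "\<dots> = (s\<^sup>2 + c\<^sup>2) * (N / 2 * norm z)\<^sup>2"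
    by (simp only: power_mult_distrib distrib_right mult.assoc)
  finally have "(norm (k *\<^sub>C X - (s * N / 2) *\<^sub>R z))\<^sup>2 \<le> (N / 2 * norm z)\<^sup>2"
    by (simp add: unit)
  then show ?thesis
    unfolding k_def by (rule power2_le_imp_le) (simp add: N)
qed

lemma buzano_rotated:
  fixes a b X Y y :: "'a :: chilbert_space" and s c N :: real
  assumes unit: "s\<^sup>2 + c\<^sup>2 = 1"
    and y: "y = s *\<^sub>R X + c *\<^sub>R Y"
    and N: "N = (norm X)\<^sup>2 + (norm Y)\<^sup>2"
  shows "2 * cmod (cinner a y) * cmod (cinner X b)
           \<le> N * (norm a * norm b + \<bar>s\<bar> * cmod (cinner a b))"
proof -
  let ?T = "cinner a y *\<^sub>C X - (s * N / 2) *\<^sub>R a"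
  have "cinner a y * cinner X b = cinner ?T b + of_real (s * N / 2) * cinner a b"
    by (simp add: cinner_diff_left cinner_scaleC_left cinner_scaleR_left)
  then have "cmod (cinner a y) * cmod (cinner X b)
               \<le> cmod (cinner ?T b) + cmod (of_real (s * N / 2) * cinner a b)"
    by (metis norm_mult norm_triangle_ineq)
  also have "cmod (of_real (s * N / 2) * cinner a b) = N / 2 * (\<bar>s\<bar> * cmod (cinner a b))"
    by (simp add: N norm_mult abs_mult del: of_real_mult of_real_divide)
  also have "cmod (cinner ?T b) \<le> N / 2 * (norm a * norm b)"
    using order_trans[OF cinner_Cauchy_Schwarz
        mult_right_mono[OF norm_shifted_rank_one_le[OF unit y N] norm_ge_zero]]
    by (simp add: mult.assoc)
  finally show ?thesis
    by (simp add: algebra_simps)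
qed

section \<open>Rotation to the principal axis\<close>

text \<open>
  Here \<open>p\<close>, \<open>q\<close> and \<open>r\<close> are the entries of a real symmetric two by two matrix, \<open>\<Delta>\<close> is its eigenvalue
  gap and \<open>(c, s)\<close> a unit eigenvector for the larger eigenvalue. The half angle formulas fix the
  absolute values of \<open>s\<close> and \<open>c\<close>; since \<open>s \<ge> 0\<close>, the
  eigenvector equation, in the form \<open>s c \<Delta> = r\<close>, makes \<open>c\<close> take the sign of \<open>r\<close>.
\<close>

lemma principal_axis:
  fixes p q r \<Delta> :: real
  assumes gap: "\<Delta>\<^sup>2 = (p - q)\<^sup>2 + 4 * r\<^sup>2" and pos: "\<Delta> > 0"
  defines "s \<equiv> sqrt ((\<Delta> - p + q) / (2 * \<Delta>))"
  obtains c where "s \<ge> 0" and "s\<^sup>2 + c\<^sup>2 = 1" and "c\<^sup>2 * p + s\<^sup>2 * q + 2 * (s * c) * r = (p + q + \<Delta>) / 2"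
proof -
  define c where "c = (if r \<ge> 0 then 1 else - 1) * sqrt ((\<Delta> + p - q) / (2 * \<Delta>))"
  have "\<bar>p - q\<bar> \<le> \<Delta>"
    by (rule power2_le_imp_le) (use gap pos in auto)
  then have s2: "s\<^sup>2 = (\<Delta> - p + q) / (2 * \<Delta>)" and c2: "c\<^sup>2 = (\<Delta> + p - q) / (2 * \<Delta>)"
    using pos by (auto simp: s_def c_def power_mult_distrib)
  have "(\<Delta> - p + q) / (2 * \<Delta>) * ((\<Delta> + p - q) / (2 * \<Delta>)) = (\<Delta>\<^sup>2 - (p - q)\<^sup>2) / (2 * \<Delta>)\<^sup>2"
    by (simp add: power2_eq_square algebra_simps)
  also have "\<dots> = (r / \<Delta>)\<^sup>2"
    unfolding gap using pos by (simp add: power_divide power_mult_distrib)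
  finally have "sqrt ((\<Delta> - p + q) / (2 * \<Delta>)) * sqrt ((\<Delta> + p - q) / (2 * \<Delta>)) = \<bar>r\<bar> / \<Delta>"
    using pos by (simp flip: real_sqrt_mult)
  then have sc: "s * c = r / \<Delta>"
    by (simp add: s_def c_def)
  show ?thesis
  proof
    show "s \<ge> 0"
      using \<open>\<bar>p - q\<bar> \<le> \<Delta>\<close> pos by (simp add: s_def)
    show "s\<^sup>2 + c\<^sup>2 = 1"
      using pos by (simp add: s2 c2 field_simps)
    have "c\<^sup>2 * p + s\<^sup>2 * q + 2 * (s * c) * r = ((p + q) * \<Delta> + ((p - q)\<^sup>2 + 4 * r\<^sup>2)) / (2 * \<Delta>)"
      unfolding s2 c2 sc using pos by (simp add: field_simps power2_eq_square)
    also have "\<dots> = (p + q + \<Delta>) / 2"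
      unfolding gap[symmetric] using pos by (simp add: field_simps power2_eq_square)
    finally show "c\<^sup>2 * p + s\<^sup>2 * q + 2 * (s * c) * r = (p + q + \<Delta>) / 2" .
  qed
qed

lemma power2_norm_rotate:
  fixes x y :: "'a :: chilbert_space"
  assumes "s\<^sup>2 + c\<^sup>2 = 1"
  shows "(norm (c *\<^sub>R x + s *\<^sub>R y))\<^sup>2 + (norm (c *\<^sub>R y + (- s) *\<^sub>R x))\<^sup>2 = (norm x)\<^sup>2 + (norm y)\<^sup>2"
proof -
  have "Re (cinner y x) = Re (cinner x y)"
    by (subst cinner_commute) simp
  then have "(norm (c *\<^sub>R x + s *\<^sub>R y))\<^sup>2 + (norm (c *\<^sub>R y + (- s) *\<^sub>R x))\<^sup>2
             = (s\<^sup>2 + c\<^sup>2) * ((norm x)\<^sup>2 + (norm y)\<^sup>2)"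
    unfolding power2_norm_add
    by (simp add: cinner_scaleR_left cinner_scaleR_right power_mult_distrib algebra_simps del: scaleR_minus_left)
  then show ?thesis by (simp add: assms)
qed

theorem corollary2p2:
  fixes a b x y :: "'a :: chilbert_space"
    and \<Delta> \<delta> :: real
  assumes Delta: "\<Delta> = sqrt (((cmod (cinner x b))\<^sup>2 + (cmod (cinner y b))\<^sup>2)\<^sup>2
                         - 4 * (Im (cinner x b * cinner b y))\<^sup>2)"
    and Delta_pos: "\<Delta> > 0"
    and delta: "\<delta> = sqrt ((\<Delta> - (cmod (cinner x b))\<^sup>2 + (cmod (cinner y b))\<^sup>2) / (2 * \<Delta>))"
  shows "cmod (cinner a y) \<le>
           (((norm x)\<^sup>2 + (norm y)\<^sup>2) * (norm a * norm b + \<delta> * cmod (cinner a b)))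
           / sqrt (2 * ((cmod (cinner x b))\<^sup>2 + (cmod (cinner y b))\<^sup>2 + \<Delta>))"
proof -
  define u v r where "u = cinner x b" and "v = cinner y b" and "r = Re (u * cnj v)"
  define p q where "p = (cmod u)\<^sup>2" and "q = (cmod v)\<^sup>2"
  have "cinner b y = cnj v"
    unfolding v_def by (rule cinner_commute)
  moreover have "(p + q)\<^sup>2 - 4 * (Im (u * cnj v))\<^sup>2 = (p - q)\<^sup>2 + 4 * r\<^sup>2"
    unfolding p_def q_def r_def cmod_power2 by (simp add: power2_eq_square algebra_simps)
  ultimately have "\<Delta> = sqrt ((p - q)\<^sup>2 + 4 * r\<^sup>2)"
    using Delta by (simp add: p_def q_def flip: u_def v_def)
  then have gap: "\<Delta>\<^sup>2 = (p - q)\<^sup>2 + 4 * r\<^sup>2"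
    by simp
  have \<delta>: "\<delta> = sqrt ((\<Delta> - p + q) / (2 * \<Delta>))"
    by (simp add: delta p_def q_def u_def v_def)
  obtain c where "\<delta> \<ge> 0" and unit: "\<delta>\<^sup>2 + c\<^sup>2 = 1"
    and top: "c\<^sup>2 * p + \<delta>\<^sup>2 * q + 2 * (\<delta> * c) * r = (p + q + \<Delta>) / 2"
    using principal_axis[OF gap Delta_pos] unfolding \<delta> by blast
  define X Y where "X = c *\<^sub>R x + \<delta> *\<^sub>R y" and "Y = c *\<^sub>R y + (- \<delta>) *\<^sub>R x"
  have "\<delta> *\<^sub>R X + c *\<^sub>R Y = (\<delta>\<^sup>2 + c\<^sup>2) *\<^sub>R y"
    by (simp add: X_def Y_def algebra_simps power2_eq_square)
  then have y: "y = \<delta> *\<^sub>R X + c *\<^sub>R Y"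
    by (simp add: unit)
  have "cinner X b = of_real c * u + of_real \<delta> * v"
    by (simp add: X_def u_def v_def cinner_add_left cinner_scaleR_left)
  then have "(cmod (cinner X b))\<^sup>2 = c\<^sup>2 * p + \<delta>\<^sup>2 * q + 2 * (\<delta> * c) * r"
    unfolding p_def q_def r_def cmod_power2 by (simp add: power2_eq_square algebra_simps)
  then have "2 * (p + q + \<Delta>) = (2 * cmod (cinner X b))\<^sup>2"
    by (simp add: top power_mult_distrib)
  then have denominator: "sqrt (2 * (p + q + \<Delta>)) = 2 * cmod (cinner X b)"
    by (simp only: real_sqrt_abs) simp
  note \<open>\<delta> \<ge> 0\<close>
  moreover have "0 < sqrt (2 * (p + q + \<Delta>))"
    using Delta_pos by (simp add: p_def q_def add_nonneg_pos)
  ultimately have "cmod (cinner a y)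
      \<le> (((norm x)\<^sup>2 + (norm y)\<^sup>2) * (norm a * norm b + \<delta> * cmod (cinner a b)))
        / sqrt (2 * (p + q + \<Delta>))"
    using buzano_rotated[OF unit y refl, of a b]
    unfolding denominator X_def Y_def power2_norm_rotate[OF unit]
    by (simp add: pos_le_divide_eq mult_ac)
  then show ?thesis
    by (simp add: p_def q_def u_def v_def)
qed

end
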